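(* Let $m\ge 1$ and consider the linear delay system $$\dot{x}_i(t)=\sum_{j=1}^m a_{ij}(t)x_j(g_{ij}(t)),\qquad t\ge t_0,\ i=1,\dots,m,$$ with $t_0\ge 0$ arbitrary and initial conditions $x_i(t)=\varphi_i(t)$, $t\le t_0$. Assume that $a_{ij}$ are Lebesgue measurable essentially bounded functions on $[0,\infty)$ with $0<\alpha_i\le -a_{ii}(t)\le A_i$ and $|a_{ij}(t)|\le A_{ij}$ for $i\ne j$; that $g_{ij}$ are measurable functions with $0\le t-g_{ij}(t)\le\sigma_{ij}$; and that $\varphi_i$ are continuous on $[t_0-\sigma,t_0]$, where $\sigma=\max_{i,j}\sigma_{ij}$. Here $\alpha_i,A_i,A_{ij},\sigma_{ij}$ are constants. Define $D=(d_{ij})_{i,j=1}^m$ by $$d_{ii}=1-\frac{A_i^2\sigma_{ii}}{\alpha_i},\qquad d_{ij}=-\frac{A_iA_{ij}\sigma_{ii}+A_{ij}}{\alpha_i}\quad(i\ne j).$$ If $D$ is an $M$-matrix, then the system is exponentially stable.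
   Context: A solution $X=(x_1,\dots,x_m)^T$ of the initial value problem is a function, locally absolutely continuous on $[t_0,\infty)$, satisfying the differential system almost everywhere for $t>t_0$ and the initial conditions for $t\le t_0$ (that is, on $[t_0-\sigma,t_0]$). $M$-matrix: a real square matrix $B=(b_{ij})$ is a (nonsingular) $M$-matrix if $b_{ij}\le 0$ for $i\ne j$ and all principal minors of $B$ are positive (equivalently, given the sign condition, $B$ is invertible with entrywise nonnegative inverse). Exponential stability: there exist $M>0$, $\lambda>0$, not depending on $t_0$, such that for every $t_0\ge 0$ and every initial function $\varphi=(\varphi_1,\dots,\varphi_m)^T$ the solution $X$ satisfies $$\|X(t)\|\le Me^{-\lambda(t-t_0)}\Bigl(\|X(t_0)\|+\sup_{t_0-\sigma\le s<t_0}\|\varphi(s)\|\Bigr),\qquad t\ge t_0,$$ where $\|\cdot\|$ is a fixed norm on $\mathbb{R}^m$ (the supremum over an empty set is read as $0$). *)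

theory Defs
  imports "HOL-Analysis.Analysis"
begin

text \<open>Absolute continuity of a function on a compact interval (the library notion
  \<open>absolutely_continuous\<close> concerns measures). A finite family of non-overlapping subintervals
  is a finite set of pairs of endpoints with pairwise disjoint open intervals.\<close>

definition abs_cont_on :: "real \<Rightarrow> real \<Rightarrow> (real \<Rightarrow> 'a::real_normed_vector) \<Rightarrow> bool" where
  "abs_cont_on a b f \<longleftrightarrow>
    (\<forall>\<epsilon>>0. \<exists>\<delta>>0. \<forall>I :: (real \<times> real) set.
      finite I \<longrightarrow>
      (\<forall>(u, v)\<in>I. a \<le> u \<and> u \<le> v \<and> v \<le> b) \<longrightarrow>
      pairwise (\<lambda>(u, v) (u', v'). {u<..<v} \<inter> {u'<..<v'} = {}) I \<longrightarrow>
      (\<Sum>(u, v)\<in>I. v - u) < \<delta> \<longrightarrow>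
      (\<Sum>(u, v)\<in>I. norm (f v - f u)) < \<epsilon>)"

definition locally_abs_cont_from :: "real \<Rightarrow> (real \<Rightarrow> 'a::real_normed_vector) \<Rightarrow> bool" where
  "locally_abs_cont_from t0 f \<longleftrightarrow> (\<forall>b>t0. abs_cont_on t0 b f)"

definition is_norm :: "('a::real_vector \<Rightarrow> real) \<Rightarrow> bool" where
  "is_norm N \<longleftrightarrow>
    (\<forall>x. 0 \<le> N x) \<and> (\<forall>x. N x = 0 \<longleftrightarrow> x = 0) \<and>
    (\<forall>c x. N (c *\<^sub>R x) = \<bar>c\<bar> * N x) \<and> (\<forall>x y. N (x + y) \<le> N x + N y)"

text \<open>The Leibniz formula for the determinant of the submatrix with row and column set \<open>S\<close>;
  for \<open>S = UNIV\<close> it is \<open>det\<close>.\<close>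

definition principal_minor :: "real^'m^'m \<Rightarrow> 'm set \<Rightarrow> real" where
  "principal_minor B S =
    (\<Sum>p | p permutes S. of_int (sign p) * (\<Prod>i\<in>S. B $ i $ p i))"

definition M_matrix :: "real^'m^'m \<Rightarrow> bool" where
  "M_matrix B \<longleftrightarrow>
    (\<forall>i j. i \<noteq> j \<longrightarrow> B $ i $ j \<le> 0) \<and>
    (\<forall>S. S \<noteq> {} \<longrightarrow> principal_minor B S > 0)"

text \<open>The system is given by the coefficients \<open>a\<close>, the delayed arguments \<open>g\<close> and the length
  \<open>\<sigma>\<close> of the initial interval. Only the values of \<open>X\<close> on \<open>[t0 - \<sigma>, \<infinity>)\<close> matter.\<close>

definition is_solution ::
  "('m \<Rightarrow> 'm \<Rightarrow> real \<Rightarrow> real) \<Rightarrow> ('m \<Rightarrow> 'm \<Rightarrow> real \<Rightarrow> real) \<Rightarrow> real \<Rightarrow>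
    real \<Rightarrow> (real \<Rightarrow> real^'m) \<Rightarrow> (real \<Rightarrow> real^'m::finite) \<Rightarrow> bool" where
  "is_solution a g \<sigma> t0 \<phi> X \<longleftrightarrow>
    locally_abs_cont_from t0 X \<and>
    (AE t in lebesgue_on {t0<..}. \<forall>i.
      ((\<lambda>s. X s $ i) has_real_derivative (\<Sum>j\<in>UNIV. a i j t * X (g i j t) $ j)) (at t)) \<and>
    (\<forall>t\<in>{t0 - \<sigma>..t0}. X t = \<phi> t)"

text \<open>The supremum over the empty set is read as \<open>0\<close>; \<open>Sup {}\<close> is unspecified on \<^typ>\<open>real\<close>.\<close>

definition sup_or_zero :: "real set \<Rightarrow> real" where
  "sup_or_zero S = (if S = {} then 0 else Sup S)"

definition exponentially_stable ::
  "(real^'m \<Rightarrow> real) \<Rightarrow> ('m::finite \<Rightarrow> 'm \<Rightarrow> real \<Rightarrow> real) \<Rightarrow> ('m \<Rightarrow> 'm \<Rightarrow> real \<Rightarrow> real) \<Rightarrow>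
    real \<Rightarrow> bool" where
  "exponentially_stable N a g \<sigma> \<longleftrightarrow>
    (\<exists>M>0. \<exists>\<gamma>>0. \<forall>t0\<ge>0. \<forall>\<phi> X.
      continuous_on {t0 - \<sigma>..t0} \<phi> \<longrightarrow> is_solution a g \<sigma> t0 \<phi> X \<longrightarrow>
      (\<forall>t\<ge>t0. N (X t) \<le>
        M * exp (- \<gamma> * (t - t0)) *
          (N (X t0) + sup_or_zero ((\<lambda>s. N (\<phi> s)) ` {t0 - \<sigma>..<t0}))))"

definition comparison_matrix ::
  "('m \<Rightarrow> real) \<Rightarrow> ('m \<Rightarrow> real) \<Rightarrow> ('m \<Rightarrow> 'm \<Rightarrow> real) \<Rightarrow> ('m \<Rightarrow> 'm \<Rightarrow> real) \<Rightarrow> real^'m^'m" where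
  "comparison_matrix \<alpha> A B \<sigma> =
    (\<chi> i j. if i = j then 1 - (A i)\<^sup>2 * \<sigma> i i / \<alpha> i
            else - ((A i * B i j * \<sigma> i i + B i j) / \<alpha> i))"

end

theory Submission
  imports Defs
begin

text \<open>The diagonal term of each equation is dissipative up to the error made by replacing the delayed
value \<open>x i (g i i t)\<close> by \<open>x i t\<close>. This error is the integral of the derivative over an interval of length at
most \<open>\<sigma> i i\<close>, and the derivative is bounded through the equation by \<open>A i\<close> and \<open>B i j\<close> times the components.
Hence \<open>x i' = a i i t * x i + f i\<close>, where \<open>\<bar>f i\<bar>\<close> is at most
\<open>A i * \<sigma> i i * (A i * u i + (\<Sum>j\<noteq>i. B i j * u j)) + (\<Sum>j\<noteq>i. B i j * u j)\<close>
if every \<open>\<bar>x j\<bar>\<close> is bounded by \<open>u j\<close>. Since the coefficient \<open>a i i t\<close> is at most \<open>- \<alpha> i\<close>, the component \<open>x i\<close> is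
eventually governed by \<open>\<bar>f i\<bar> / \<alpha> i\<close>, and the coefficients of \<open>u\<close> in this bound are exactly the entries of the
identity minus the comparison matrix \<open>D\<close>.

An M-matrix \<open>D\<close> admits a vector \<open>v > 0\<close> with \<open>D *v v > 0\<close> (\<open>M_matrix_semipositive\<close>). In the maximum norm weighted
by \<open>v\<close> the bound above is therefore a strict contraction. Strictness leaves room for a small exponential
rate: all estimates are carried out relative to \<open>exp (- l * (t - t0))\<close>, which only multiplies the coefficients
by powers of \<open>exp (l * r)\<close> and lowers \<open>\<alpha> i\<close> to \<open>\<alpha> i - l\<close>, where \<open>r\<close> is the maximal delay
(\<open>exists_rate_with_positive_margin\<close>). Absorbing the contracted part gives a bound by the initial data
that is uniform in time and in \<open>t0\<close> (\<open>weighted_exponential_bound\<close>).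

Solutions are only absolutely continuous, with derivatives almost everywhere. Both places where this
matters, the increment over a delay and the comparison with an exponential, reduce to one fact: an
absolutely continuous function whose derivative is almost everywhere nonpositive does not increase
(\<open>abs_cont_on_deriv_nonpos_imp_le\<close>).\<close>

section \<open>M-matrices and positive vectors\<close>

text \<open>Replacing the rows outside \<open>S\<close> by unit vectors turns every principal minor into a determinant
  of one fixed size, so that linear algebra for \<^const>\<open>det\<close> applies while the index set grows.\<close>

definition row_restriction :: "real^'m^'m \<Rightarrow> 'm set \<Rightarrow> real^'m^'m" where
  "row_restriction B S = (\<chi> i. if i \<in> S then row i B else axis i 1)"

text \<open>A permutation that moves an index outside \<open>S\<close> meets a zero of a unit row, so only the
  permutations of \<open>S\<close> survive in the Leibniz formula.\<close>

lemma det_row_restriction: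
  fixes B :: "real^'m::finite^'m"
  shows "det (row_restriction B S) = principal_minor B S"
proof -
  let ?R = "row_restriction B S"
  have "det ?R = (\<Sum>p | p permutes UNIV. of_int (sign p) * (\<Prod>i\<in>UNIV. ?R $ i $ p i))"
    by (simp add: det_def)
  also have "\<dots> = (\<Sum>p | p permutes S. of_int (sign p) * (\<Prod>i\<in>UNIV. ?R $ i $ p i))"
  proof (rule sum.mono_neutral_right)
    show "{p. p permutes S} \<subseteq> {p. p permutes UNIV}"
      using permutes_subset by blast
    show "\<forall>p\<in>{p. p permutes UNIV} - {p. p permutes S}.
            of_int (sign p) * (\<Prod>i\<in>UNIV. ?R $ i $ p i) = 0"
    proof
      fix p assume p: "p \<in> {p. p permutes UNIV} - {p. p permutes S}"
      then obtain i where "i \<notin> S" "p i \<noteq> i"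
        using permutes_superset[of p UNIV S] by blast
      then have "?R $ i $ p i = 0"
        by (simp add: row_restriction_def axis_def)
      then have "(\<Prod>i\<in>UNIV. ?R $ i $ p i) = 0"
        by (intro prod_zero) auto
      then show "of_int (sign p) * (\<Prod>i\<in>UNIV. ?R $ i $ p i) = 0" by simp
    qed
  qed (simp add: finite_permutations)
  also have "\<dots> = principal_minor B S"
    unfolding principal_minor_def
  proof (rule sum.cong)
    fix p assume "p \<in> {p. p permutes S}"
    then have "?R $ i $ p i = (if i \<in> S then B $ i $ p i else 1)" for i
      by (auto simp: row_restriction_def row_def axis_def permutes_not_in)
    then have "(\<Prod>i\<in>UNIV. ?R $ i $ p i) = (\<Prod>i\<in>S. B $ i $ p i)"
      by (simp add: prod.If_cases)
    then show "of_int (sign p) * (\<Prod>i\<in>UNIV. ?R $ i $ p i)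
        = of_int (sign p) * (\<Prod>i\<in>S. B $ i $ p i)" by simp
  qed simp
  finally show ?thesis .
qed

text \<open>The vector \<open>z\<close> eliminates the rows in \<open>S\<close> and has the entry \<open>1\<close> at \<open>k\<close>; its value in row \<open>k\<close> is then
  the Schur complement of the block \<open>S\<close>, that is, the quotient of two consecutive minors. The
  quotient comes from Cramer's rule: row \<open>k\<close> of \<open>B\<close> is a combination of the rows of the restriction
  to \<open>S\<close>, and the coefficient of the unit row \<open>k\<close> in it is \<open>(B *v z) $ k\<close>.\<close>

lemma schur_vector:
  fixes B :: "real^'m::finite^'m"
  assumes pos: "principal_minor B S \<noteq> 0" and k: "k \<notin> S"
  obtains z where "z $ k = 1" "\<And>i. i \<notin> insert k S \<Longrightarrow> z $ i = 0"
    "\<And>i. i \<in> S \<Longrightarrow> (B *v z) $ i = 0"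
    "principal_minor B (insert k S) = (B *v z) $ k * principal_minor B S"
proof -
  let ?R = "row_restriction B S" and ?R' = "row_restriction B (insert k S)"
  obtain J where J: "?R ** J = mat 1" "J ** ?R = mat 1"
    using pos by (metis invertible_det_nz det_row_restriction invertible_def)
  define z where "z = J *v axis k 1"
  have z: "?R *v z = axis k 1"
    by (simp add: z_def matrix_vector_mul_assoc J(1))
  define x where "x = row k B v* J"
  have x: "x v* ?R = row k B"
    by (simp add: x_def vector_matrix_mul_assoc J(2))
  have R_S: "(?R *v z) $ i = (B *v z) $ i" if "i \<in> S" for i
    using that by (simp add: row_restriction_def matrix_vector_mult_def row_def)
  have R_nS: "(?R *v z) $ i = z $ i" if "i \<notin> S" for i
  proof -
    have "(?R *v z) $ i = inner (axis i 1) z"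
      using that by (simp add: row_restriction_def matrix_vector_mult_def inner_vec_def)
    then show ?thesis by (simp add: inner_axis')
  qed
  show thesis
  proof (rule that[of z])
    show "z $ k = 1"
      using R_nS[OF k] z by (simp add: axis_def)
    show "z $ i = 0" if "i \<notin> insert k S" for i
      using R_nS[of i] z that by (simp add: axis_def)
    show "(B *v z) $ i = 0" if "i \<in> S" for i
      using R_S[OF that] z that k by (cases "i = k") (auto simp: axis_def)
    have "inner x (?R *v z) = inner (row k B) z"
      using dot_lmul_matrix[of x ?R z] x by simp
    also have "\<dots> = (B *v z) $ k"
      by (simp add: matrix_vector_mult_def inner_vec_def row_def)
    finally have xk: "x $ k = (B *v z) $ k"
      by (simp add: z inner_axis)
    have comb: "(\<Sum>i\<in>UNIV. x $ i *s row i ?R) = row k B"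
      unfolding x[symmetric] by (simp add: vec_eq_iff vector_matrix_mult_def row_def mult.commute)
    have R': "?R' = (\<chi> i. if i = k then row k B else row i ?R)"
      using k by (simp add: vec_eq_iff row_restriction_def row_def)
    have "det ?R' = x $ k * det ?R"
      unfolding R' using cramer_lemma_transpose[of k x ?R] unfolding comb .
    then show "principal_minor B (insert k S) = (B *v z) $ k * principal_minor B S"
      by (simp add: xk det_row_restriction)
  qed
qed

text \<open>Induction over the index set. Given \<open>v\<close> for \<open>S\<close>, the elimination vector \<open>z\<close> for a new index \<open>k\<close>
  satisfies \<open>B *v z = 0\<close> on \<open>S\<close> and \<open>(B *v z) $ k > 0\<close>. It is nonnegative on \<open>S\<close>: at an index \<open>p\<close> of \<open>S\<close>
  with the least quotient \<open>z $ p / v $ p\<close>, a negative quotient would contradict row \<open>p\<close> of the system.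
  Adding a small multiple of \<open>v\<close> makes everything positive.\<close>

lemma Z_matrix_semipositive_on:
  fixes B :: "real^'m::finite^'m"
  assumes Z: "\<And>i j. i \<noteq> j \<Longrightarrow> B $ i $ j \<le> 0"
    and minors: "\<And>S. S \<noteq> {} \<Longrightarrow> principal_minor B S > 0"
  shows "\<exists>v. (\<forall>i\<in>S. v $ i > 0) \<and> (\<forall>i. i \<notin> S \<longrightarrow> v $ i = 0) \<and> (\<forall>i\<in>S. (B *v v) $ i > 0)"
proof (induction S rule: finite_induct[OF finite])
  case 1 
  show ?case by (intro exI[of _ 0]) simp
next
  case (2 k S)
  then obtain v where v: "\<And>i. i \<in> S \<Longrightarrow> v $ i > 0" "\<And>i. i \<notin> S \<Longrightarrow> v $ i = 0"
      "\<And>i. i \<in> S \<Longrightarrow> (B *v v) $ i > 0" by blast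
  have mS: "principal_minor B S > 0"
  proof (cases "S = {}")
    case True
    then show ?thesis by (simp add: principal_minor_def sign_id)
  qed (rule minors)
  obtain z where z: "z $ k = 1" "\<And>i. i \<notin> insert k S \<Longrightarrow> z $ i = 0"
    "\<And>i. i \<in> S \<Longrightarrow> (B *v z) $ i = 0"
    "principal_minor B (insert k S) = (B *v z) $ k * principal_minor B S"
    using schur_vector[of B S k] mS 2 by (metis less_irrefl)
  have Bzk: "(B *v z) $ k > 0"
    using z(4) minors[of "insert k S"] mS by (simp add: zero_less_mult_iff)
  have z_nonneg: "z $ i \<ge> 0" if i: "i \<in> S" for i
  proof (rule ccontr)
    assume neg: "\<not> z $ i \<ge> 0"
    define q where "q j = z $ j / v $ j" for j
    define l where "l = arg_min_on q S"
    have l: "l \<in> S" "\<And>j. j \<in> S \<Longrightarrow> q l \<le> q j"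
      unfolding l_def using arg_min_if_finite(1)[of S q] arg_min_least[of S _ q] i by auto
    have ql: "q l < 0"
      using l(2)[OF i] neg v(1)[OF i] unfolding q_def
      by (smt (verit) divide_neg_pos)
    \<comment> \<open>Subtracting the least quotient times \<open>v\<close> leaves a nonnegative vector that vanishes at \<open>l\<close>;
  the signs of the off-diagonal entries then force row \<open>l\<close> to be nonpositive.\<close>
    define w where "w = z - q l *\<^sub>R v"
    have "w $ j \<ge> 0" for j
    proof (cases "j \<in> S")
      case True
      then show ?thesis
        using l(2)[OF True] v(1)[OF True] by (simp add: w_def q_def[of j] pos_le_divide_eq)
    next
      case False
      then show ?thesis using v(2)[OF False] z(1) z(2)[of j] by (cases "j = k") (auto simp: w_def)
    qed
    moreover have "w $ l = 0"
      using v(1)[OF l(1)] by (simp add: w_def q_def)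
    ultimately have "(B *v w) $ l \<le> 0"
      unfolding matrix_vector_mult_def
      by (auto intro!: sum_nonpos) (metis Z mult_nonpos_nonneg mult_zero_right order_refl)
    moreover have "(B *v w) $ l = - q l * (B *v v) $ l"
      using z(3)[OF l(1)] by (simp add: w_def matrix_vector_mult_diff_distrib matrix_vector_mult_scaleR)
    moreover have "- q l * (B *v v) $ l > 0"
      using ql v(3)[OF l(1)] by (simp add: mult_neg_pos)
    ultimately show False by simp
  qed
  \<comment> \<open>A small multiple of \<open>v\<close> makes the rows in \<open>S\<close> strictly positive and keeps row \<open>k\<close> so.\<close>
  define e where "e = (B *v z) $ k / (2 * (1 + \<bar>(B *v v) $ k\<bar>))"
  have e: "e > 0" using Bzk by (simp add: e_def)
  have "e * \<bar>(B *v v) $ k\<bar> < (B *v z) $ k"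
    unfolding e_def using Bzk by (simp add: field_simps add_pos_nonneg)
  then have "- ((B *v z) $ k) < e * (B *v v) $ k"
    using e by (smt (verit) abs_ge_minus_self mult_minus_right mult_left_mono)
  then show ?case
    using v z z_nonneg e \<open>k \<notin> S\<close>
    by (intro exI[of _ "z + e *\<^sub>R v"])
       (auto simp: matrix_vector_right_distrib matrix_vector_mult_scaleR add_nonneg_pos)
qed

lemma M_matrix_semipositive:
  fixes B :: "real^'m::finite^'m"
  assumes "M_matrix B"
  obtains v where "\<And>i. v $ i > 0" "\<And>i. (B *v v) $ i > 0"
  using Z_matrix_semipositive_on[of B UNIV] assms by (auto simp: M_matrix_def)

section \<open>Monotonicity of absolutely continuous functions\<close>

definition nonoverlapping_in :: "real \<Rightarrow> real \<Rightarrow> (real \<times> real) set \<Rightarrow> bool" where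
  "nonoverlapping_in a b I \<longleftrightarrow> finite I \<and> (\<forall>(u, v)\<in>I. a \<le> u \<and> u \<le> v \<and> v \<le> b) \<and>
    pairwise (\<lambda>(u, v) (u', v'). {u<..<v} \<inter> {u'<..<v'} = {}) I"

lemma abs_cont_on_iff:
  "abs_cont_on a b f \<longleftrightarrow>
    (\<forall>\<epsilon>>0. \<exists>\<delta>>0. \<forall>I. nonoverlapping_in a b I \<longrightarrow> (\<Sum>(u, v)\<in>I. v - u) < \<delta> \<longrightarrow>
      (\<Sum>(u, v)\<in>I. norm (f v - f u)) < \<epsilon>)"
  by (simp only: abs_cont_on_def nonoverlapping_in_def imp_conjL)

text \<open>One comparison covers components of a vector function, sign changes, and perturbations by a
  Lipschitz function.\<close>

lemma abs_cont_on_dist_le: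
  fixes f :: "real \<Rightarrow> 'a::real_normed_vector" and h :: "real \<Rightarrow> 'b::real_normed_vector"
  assumes f: "abs_cont_on a b f" and L: "L \<ge> 0"
    and le: "\<And>u v. a \<le> u \<Longrightarrow> u \<le> v \<Longrightarrow> v \<le> b \<Longrightarrow> norm (h v - h u) \<le> norm (f v - f u) + L * (v - u)"
  shows "abs_cont_on a b h"
  unfolding abs_cont_on_iff
proof (intro allI impI)
  fix \<epsilon> :: real assume "\<epsilon> > 0"
  then have "\<epsilon> / 2 > 0" by simp
  then obtain d where "d > 0" and d: "\<And>I. nonoverlapping_in a b I \<Longrightarrow> (\<Sum>(u, v)\<in>I. v - u) < d \<Longrightarrow>
      (\<Sum>(u, v)\<in>I. norm (f v - f u)) < \<epsilon> / 2"
    using f unfolding abs_cont_on_iff by meson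
  define m where "m = min d (\<epsilon> / (2 * (L + 1)))"
  have "m > 0" using \<open>d > 0\<close> \<open>\<epsilon> > 0\<close> L by (simp add: m_def)
  moreover have "(\<Sum>(u, v)\<in>I. norm (h v - h u)) < \<epsilon>"
    if I: "nonoverlapping_in a b I" "(\<Sum>(u, v)\<in>I. v - u) < m" for I
  proof -
    have "(\<Sum>(u, v)\<in>I. norm (h v - h u)) \<le> (\<Sum>(u, v)\<in>I. norm (f v - f u) + L * (v - u))"
      using I(1) by (intro sum_mono) (auto simp: nonoverlapping_in_def intro: le)
    also have "\<dots> = (\<Sum>(u, v)\<in>I. norm (f v - f u)) + L * (\<Sum>(u, v)\<in>I. v - u)"
      by (simp add: sum.distrib sum_distrib_left case_prod_unfold)
    also have "(\<Sum>(u, v)\<in>I. norm (f v - f u)) < \<epsilon> / 2"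
      using I by (intro d) (auto simp: m_def)
    also have "L * (\<Sum>(u, v)\<in>I. v - u) \<le> L * (\<epsilon> / (2 * (L + 1)))"
      using I(2) L by (intro mult_left_mono) (auto simp: m_def)
    also have "\<dots> \<le> \<epsilon> / 2"
      using L \<open>\<epsilon> > 0\<close> by (simp add: field_simps)
    finally show ?thesis by simp
  qed
  ultimately show "\<exists>\<delta>>0. \<forall>I. nonoverlapping_in a b I \<longrightarrow> (\<Sum>(u, v)\<in>I. v - u) < \<delta> \<longrightarrow>
      (\<Sum>(u, v)\<in>I. norm (h v - h u)) < \<epsilon>"
    by blast
qed

lemma abs_cont_on_subinterval:
  assumes "abs_cont_on a b f" "a \<le> c" "d \<le> b"
  shows "abs_cont_on c d f"
proof -
  have "nonoverlapping_in a b I" if "nonoverlapping_in c d I" for I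
    using that assms(2,3) by (fastforce simp: nonoverlapping_in_def)
  then show ?thesis
    using assms(1) unfolding abs_cont_on_iff by meson
qed

lemma abs_cont_on_imp_continuous_on:
  assumes "abs_cont_on a b f"
  shows "continuous_on {a..b} f"
  unfolding continuous_on_iff
proof (intro ballI allI impI)
  fix x \<epsilon> :: real assume x: "x \<in> {a..b}" and "\<epsilon> > 0"
  then obtain \<delta> where "\<delta> > 0" and \<delta>: "\<And>I. nonoverlapping_in a b I \<Longrightarrow>
      (\<Sum>(u, v)\<in>I. v - u) < \<delta> \<Longrightarrow> (\<Sum>(u, v)\<in>I. norm (f v - f u)) < \<epsilon>"
    using assms unfolding abs_cont_on_iff by meson
  have "dist (f y) (f x) < \<epsilon>" if "y \<in> {a..b}" "dist y x < \<delta>" for y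
    using \<delta>[of "{(x, y)}"] \<delta>[of "{(y, x)}"] that x
    by (cases "x \<le> y") (auto simp: nonoverlapping_in_def dist_norm norm_minus_commute)
  then show "\<exists>d>0. \<forall>x'\<in>{a..b}. dist x' x < d \<longrightarrow> dist (f x') (f x) < \<epsilon>"
    using \<open>\<delta> > 0\<close> by blast
qed

text \<open>Straddling the point \<open>x\<close> matters: for \<open>u\<close> and \<open>v\<close> on the same side of \<open>x\<close> the derivative at \<open>x\<close>
  does not control the difference quotient.\<close>

lemma straddle_upper:
  fixes f :: "real \<Rightarrow> real"
  assumes "(f has_real_derivative D) (at x)" "D \<le> 0" "e > 0"
  obtains d where "d > 0"
    "\<And>u v. \<bar>u - x\<bar> < d \<Longrightarrow> \<bar>v - x\<bar> < d \<Longrightarrow> u \<le> x \<Longrightarrow> x \<le> v \<Longrightarrow> f v - f u \<le> e * (v - u)"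
proof -
  have "\<exists>d>0. \<forall>y. norm (y - x) < d \<longrightarrow> norm (f y - f x - D * (y - x)) \<le> e * norm (y - x)"
    using assms(1,3) unfolding has_field_derivative_def has_derivative_at_alt by blast
  then obtain d where "d > 0" and d: "\<And>y. \<bar>y - x\<bar> < d \<Longrightarrow> \<bar>f y - f x - D * (y - x)\<bar> \<le> e * \<bar>y - x\<bar>"
    by auto
  have "f v - f u \<le> e * (v - u)" if "\<bar>u - x\<bar> < d" "\<bar>v - x\<bar> < d" "u \<le> x" "x \<le> v" for u v
  proof -
    have "f v - f x - D * (v - x) \<le> e * (v - x)" using d[OF that(2)] that by simp
    moreover have "f x - f u + D * (u - x) \<le> e * (x - u)" using d[OF that(1)] that by simp
    ultimately have "f v - f u \<le> (e + D) * (v - u)" by (simp add: algebra_simps)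
    also have "\<dots> \<le> e * (v - u)" using assms(2) that by (intro mult_right_mono) auto
    finally show ?thesis .
  qed
  then show thesis using \<open>d > 0\<close> that by blast
qed

lemma tagged_partial_division_sum_length_le:
  fixes T :: "real set"
  assumes q: "q tagged_partial_division_of cbox a b"
    and sub: "\<And>x K. (x, K) \<in> q \<Longrightarrow> K \<subseteq> T" and T: "T \<in> lmeasurable"
  shows "(\<Sum>(x, K)\<in>q. Sup K - Inf K) \<le> measure lebesgue T"
proof -
  have div: "snd ` q division_of \<Union> (snd ` q)"
    by (rule division_of_tagged_division[OF tagged_partial_division_of_Union_self[OF q]])
  have "(\<Sum>(x, K)\<in>q. Sup K - Inf K) = (\<Sum>(x, K)\<in>q. measure lebesgue K)"
  proof (rule sum.cong)
    fix p assume p: "p \<in> q"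
    obtain x K where pK: "p = (x, K)" by force
    then obtain u v where "K = cbox u v" "x \<in> K" using tagged_partial_division_ofD[OF q] p by metis
    then show "(case p of (x, K) \<Rightarrow> Sup K - Inf K) = (case p of (x, K) \<Rightarrow> measure lebesgue K)"
      using pK by auto
  qed simp
  also have "\<dots> = (\<Sum>K\<in>snd ` q. measure lebesgue K)"
    by (rule sum.over_tagged_division_lemma[OF tagged_partial_division_of_Union_self[OF q]])
       (simp add: content_eq_0_interior[symmetric] box_real)
  also have "\<dots> = measure lebesgue (\<Union> (snd ` q))"
  proof (rule measure_negligible_finite_Union[symmetric])
    show "finite (snd ` q)" using div by blast
    show "S \<in> lmeasurable" if "S \<in> snd ` q" for S
      using division_ofD(4)[OF div that] by auto
    show "pairwise (\<lambda>S T. negligible (S \<inter> T)) (snd ` q)"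
    proof (rule pairwiseI)
      fix K L assume KL: "K \<in> snd ` q" "L \<in> snd ` q" "K \<noteq> L"
      obtain u v u' v' where uv: "K = cbox u v" "L = cbox u' v'"
        using division_ofD(4)[OF div] KL by metis
      have "min v v' \<le> max u u'"
        using division_ofD(5)[OF div KL] uv by (auto simp: interior_cbox)
      then have "K \<inter> L \<subseteq> {max u u'}"
        using uv by (auto simp: max_def min_def split: if_splits)
      then show "negligible (K \<inter> L)"
        by (rule negligible_subset[rotated]) simp
    qed
  qed
  also have "\<dots> \<le> measure lebesgue T"
  proof (rule measure_mono_fmeasurable[OF _ _ T])
    show "\<Union> (snd ` q) \<subseteq> T" using sub by fastforce
    have "compact (\<Union> (snd ` q))"
      using division_ofD(1,4)[OF div] by (metis compact_Union compact_cbox)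
    then show "\<Union> (snd ` q) \<in> sets lebesgue"
      by (simp add: fmeasurableD lmeasurable_compact)
  qed
  finally show ?thesis .
qed

text \<open>Cousin's lemma replaces integration here. At points where the derivative exists and is
  nonpositive the gauge controls the increment by the straddle estimate. At points of the null
  set it forces the intervals into an open set of small measure, so that absolute continuity makes
  their total increment small.\<close>

lemma abs_cont_on_deriv_nonpos_imp_le:
  fixes f :: "real \<Rightarrow> real"
  assumes "a \<le> b" and ac: "abs_cont_on a b f" and E: "negligible E"
    and deriv: "\<And>t. t \<in> {a<..<b} - E \<Longrightarrow> \<exists>D\<le>0. (f has_real_derivative D) (at t)"
  shows "f b \<le> f a"
proof (rule field_le_epsilon)
  fix \<epsilon> :: real assume "\<epsilon> > 0"
  define e where "e = \<epsilon> / (2 * (b - a + 1))"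
  have e: "e > 0" using \<open>a \<le> b\<close> \<open>\<epsilon> > 0\<close> by (simp add: e_def)
  \<comment> \<open>The endpoints are possible tags, but the derivative is known only in the interior.\<close>
  define E' where "E' = E \<union> {a, b}"
  have E': "negligible E'" using E by (simp add: E'_def negligible_Un)
  have "\<epsilon> / 2 > 0" using \<open>\<epsilon> > 0\<close> by simp
  then obtain \<delta> where "\<delta> > 0" and \<delta>: "\<And>I. nonoverlapping_in a b I \<Longrightarrow>
      (\<Sum>(u, v)\<in>I. v - u) < \<delta> \<Longrightarrow> (\<Sum>(u, v)\<in>I. norm (f v - f u)) < \<epsilon> / 2"
    using ac unfolding abs_cont_on_iff by meson
  obtain T where T: "open T" "E' \<subseteq> T" "T - E' \<in> lmeasurable" "emeasure lebesgue (T - E') < ennreal \<delta>"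
    using sets_lebesgue_outer_open[of E' \<delta>] E' \<open>\<delta> > 0\<close> by (auto simp: negligible_imp_sets)
  have T_eq: "T = (T - E') \<union> E'" using T(2) by blast
  have T_meas: "T \<in> lmeasurable"
    using T_eq T(3) E' by (metis fmeasurable.Un negligible_imp_measurable)
  have "measure lebesgue T = measure lebesgue (T - E')"
    using measure_Un_null_set[of "T - E'" lebesgue E'] T_eq T(3) E' by (simp add: negligible_iff_null_sets fmeasurableD)
  also have "\<dots> < \<delta>"
    using T(4) by (simp add: emeasure_eq_measure2[OF T(3)] ennreal_less_iff)
  finally have T_lt: "measure lebesgue T < \<delta>" .
  have "\<exists>S. open S \<and> x \<in> S \<and> (x \<in> E' \<longrightarrow> S \<subseteq> T) \<and> (x \<in> {a..b} \<longrightarrow> x \<notin> E' \<longrightarrow>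
      (\<forall>u\<in>S. \<forall>v\<in>S. u \<le> x \<longrightarrow> x \<le> v \<longrightarrow> f v - f u \<le> e * (v - u)))" for x
  proof (cases "x \<in> {a..b} \<and> x \<notin> E'")
    case True
    then obtain D where "D \<le> 0" "(f has_real_derivative D) (at x)"
      using deriv[of x] by (auto simp: E'_def)
    then obtain d where "d > 0"
      "\<And>u v. \<bar>u - x\<bar> < d \<Longrightarrow> \<bar>v - x\<bar> < d \<Longrightarrow> u \<le> x \<Longrightarrow> x \<le> v \<Longrightarrow> f v - f u \<le> e * (v - u)"
      using straddle_upper e by metis
    then show ?thesis using True by (intro exI[of _ "ball x d"]) (auto simp: dist_real_def)
  next
    case False
    then show ?thesis using T by (intro exI[of _ "if x \<in> E' then T else UNIV"]) auto
  qed
  then obtain \<gamma> where \<gamma>: "\<And>x. open (\<gamma> x)" "\<And>x. x \<in> \<gamma> x" "\<And>x. x \<in> E' \<Longrightarrow> \<gamma> x \<subseteq> T"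
    "\<And>x u v. \<lbrakk>x \<in> {a..b}; x \<notin> E'; u \<in> \<gamma> x; v \<in> \<gamma> x; u \<le> x; x \<le> v\<rbrakk> \<Longrightarrow> f v - f u \<le> e * (v - u)"
    by metis
  obtain p where p: "p tagged_division_of {a..b}" and fine: "\<gamma> fine p"
    using fine_division_exists_real[of \<gamma>] \<gamma>(1,2) by (auto simp: gauge_def)
  have pK: "\<exists>u v. K = {u..v} \<and> a \<le> u \<and> u \<le> x \<and> x \<le> v \<and> v \<le> b" if xK: "(x, K) \<in> p" for x K
  proof -
    obtain u v where uv: "K = cbox u v" using tagged_division_ofD(4)[OF p xK] by blast
    have "x \<in> K" "K \<subseteq> {a..b}" using tagged_division_ofD(2,3)[OF p xK] by auto
    then show ?thesis using uv by (intro exI[of _ u] exI[of _ v]) auto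
  qed
  have fin: "finite p" using p by auto
  define q where "q = {(x, K) \<in> p. x \<in> E'}"
  have q: "q tagged_partial_division_of cbox a b"
    using p unfolding q_def tagged_division_of_def box_real[symmetric]
    by (auto intro: tagged_partial_division_subset)
  have "f b - f a = (\<Sum>(x, K)\<in>p. f (Sup K) - f (Inf K))"
    using additive_tagged_division_1[OF \<open>a \<le> b\<close> p, of f] by simp
  also have "\<dots> = (\<Sum>(x, K)\<in>p - q. f (Sup K) - f (Inf K)) + (\<Sum>(x, K)\<in>q. f (Sup K) - f (Inf K))"
    by (rule sum.subset_diff) (auto simp: q_def fin)
  also have "(\<Sum>(x, K)\<in>p - q. f (Sup K) - f (Inf K)) \<le> \<epsilon> / 2"
  proof -
    have "(\<Sum>(x, K)\<in>p - q. f (Sup K) - f (Inf K)) \<le> (\<Sum>(x, K)\<in>p - q. e * (Sup K - Inf K))"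
    proof (rule sum_mono)
      fix y assume y: "y \<in> p - q"
      obtain x K where xK: "y = (x, K)" by force
      obtain u v where uv: "K = {u..v}" "a \<le> u" "u \<le> x" "x \<le> v" "v \<le> b"
        using pK y xK by blast
      have "K \<subseteq> \<gamma> x" using fine y xK by (auto simp: fine_def)
      then have "f v - f u \<le> e * (v - u)"
        using y xK uv by (intro \<gamma>(4)[of x]) (auto simp: q_def)
      then show "(case y of (x, K) \<Rightarrow> f (Sup K) - f (Inf K)) \<le> (case y of (x, K) \<Rightarrow> e * (Sup K - Inf K))"
        using uv xK by simp
    qed
    also have "\<dots> \<le> (\<Sum>(x, K)\<in>p. e * (Sup K - Inf K))"
      using fin e pK by (intro sum_mono2) (force+)
    also have "\<dots> = e * (b - a)"
      using additive_tagged_division_1[OF \<open>a \<le> b\<close> p, of "\<lambda>x. x"]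
      by (simp add: sum_distrib_left[symmetric] case_prod_unfold)
    also have "\<dots> \<le> \<epsilon> / 2"
      using \<open>a \<le> b\<close> \<open>\<epsilon> > 0\<close> by (simp add: e_def field_simps)
    finally show ?thesis .
  qed
  also have "(\<Sum>(x, K)\<in>q. f (Sup K) - f (Inf K)) \<le> \<epsilon> / 2"
  proof -
    define J where "J = (\<lambda>K::real set. (Inf K, Sup K)) ` snd ` q"
    have qK: "\<exists>u v. K = {u..v} \<and> a \<le> u \<and> u \<le> v \<and> v \<le> b" if "K \<in> snd ` q" for K
      using that pK by (fastforce simp: q_def)
    have div: "snd ` q division_of \<Union> (snd ` q)"
      by (rule division_of_tagged_division[OF tagged_partial_division_of_Union_self[OF q]])
    have inj: "inj_on (\<lambda>K::real set. (Inf K, Sup K)) (snd ` q)"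
    proof (rule inj_onI)
      fix K L assume "K \<in> snd ` q" "L \<in> snd ` q" "(Inf K, Sup K) = (Inf L, Sup L)"
      then show "K = L" using qK[of K] qK[of L] by auto
    qed
    \<comment> \<open>Two tags may share a degenerate interval, so passing from tagged intervals to pairs of
  endpoints is not injective; such intervals contribute \<open>0\<close>.\<close>
    have over: "(\<Sum>(x, K)\<in>q. h (Sup K) (Inf K)) = (\<Sum>(u, v)\<in>J. h v u)"
      if "\<And>u. h u u = 0" for h :: "real \<Rightarrow> real \<Rightarrow> real"
    proof -
      have "(\<Sum>(x, K)\<in>q. (if K = {} then 0 else h (Sup K) (Inf K)))
          = (\<Sum>K\<in>snd ` q. if K = {} then 0 else h (Sup K) (Inf K))"
      proof (rule sum.over_tagged_division_lemma[OF tagged_partial_division_of_Union_self[OF q]])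
        fix u v :: real assume "box u v = {}"
        then have "v \<le> u" by simp
        then show "(if cbox u v = {} then 0 else h (Sup (cbox u v)) (Inf (cbox u v))) = 0"
          using that by (cases "u = v") auto
      qed
      moreover have "(\<Sum>(x, K)\<in>q. (if K = {} then 0 else h (Sup K) (Inf K))) = (\<Sum>(x, K)\<in>q. h (Sup K) (Inf K))"
        using qK by (intro sum.cong) force+
      moreover have "(\<Sum>K\<in>snd ` q. if K = {} then 0 else h (Sup K) (Inf K)) = (\<Sum>K\<in>snd ` q. h (Sup K) (Inf K))"
        using qK by (intro sum.cong) force+
      ultimately show ?thesis
        by (simp add: J_def sum.reindex[OF inj] o_def case_prod_unfold)
    qed
    have "(\<Sum>(x, K)\<in>q. f (Sup K) - f (Inf K)) \<le> (\<Sum>(x, K)\<in>q. norm (f (Sup K) - f (Inf K)))"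
      by (rule sum_mono) auto
    also have "\<dots> = (\<Sum>(u, v)\<in>J. norm (f v - f u))"
      by (rule over) simp
    also have "\<dots> < \<epsilon> / 2"
    proof (rule \<delta>)
      have "finite q" by (rule finite_subset[OF _ fin]) (auto simp: q_def)
      then have "finite J" by (simp add: J_def)
      moreover have "a \<le> u \<and> u \<le> v \<and> v \<le> b" if "(u, v) \<in> J" for u v
        using that qK by (fastforce simp: J_def)
      moreover have "pairwise (\<lambda>(u, v) (u', v'). {u<..<v} \<inter> {u'<..<v'} = {}) J"
      proof (rule pairwiseI)
        fix s t assume st: "s \<in> J" "t \<in> J" "s \<noteq> t"
        then obtain K L where KL: "K \<in> snd ` q" "L \<in> snd ` q" "s = (Inf K, Sup K)" "t = (Inf L, Sup L)"
          by (auto simp: J_def)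
        then have "K \<noteq> L" using st(3) by auto
        then have "interior K \<inter> interior L = {}"
          by (rule division_ofD(5)[OF div KL(1,2)])
        then show "(case s of (u, v) \<Rightarrow> \<lambda>(u', v'). {u<..<v} \<inter> {u'<..<v'} = {}) t"
          using qK[OF KL(1)] qK[OF KL(2)] KL(3,4) by auto
      qed
      ultimately show "nonoverlapping_in a b J"
        by (auto simp: nonoverlapping_in_def)
      have "(\<Sum>(u, v)\<in>J. v - u) = (\<Sum>(x, K)\<in>q. Sup K - Inf K)"
        by (rule over[symmetric]) simp
      also have "\<dots> \<le> measure lebesgue T"
        using fine \<gamma>(3) by (intro tagged_partial_division_sum_length_le[OF q _ T_meas]) (force simp: q_def fine_def)
      finally show "(\<Sum>(u, v)\<in>J. v - u) < \<delta>" using T_lt by simp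
    qed
    finally show ?thesis by simp
  qed
  finally show "f b \<le> f a + \<epsilon>" by simp
qed

section \<open>Exponential comparison\<close>

lemma abs_cont_on_deriv_bounded_imp_dist_le:
  fixes f :: "real \<Rightarrow> real"
  assumes "a \<le> b" and ac: "abs_cont_on a b f" and E: "negligible E"
    and deriv: "\<And>t. t \<in> {a<..<b} - E \<Longrightarrow> \<exists>D. (f has_real_derivative D) (at t) \<and> \<bar>D\<bar> \<le> K"
  shows "\<bar>f b - f a\<bar> \<le> K * (b - a)"
proof -
  have le: "c * f b - K * b \<le> c * f a - K * a" if c: "c = 1 \<or> c = -1" for c :: real
  proof (rule abs_cont_on_deriv_nonpos_imp_le[OF \<open>a \<le> b\<close> _ E, where f = "\<lambda>t. c * f t - K * t"])
    show "abs_cont_on a b (\<lambda>t. c * f t - K * t)"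
    proof (rule abs_cont_on_dist_le[OF ac, of "\<bar>K\<bar>"])
      fix u v :: real assume "u \<le> v"
      have "\<bar>K * (v - u)\<bar> = \<bar>K\<bar> * (v - u)" using \<open>u \<le> v\<close> by (simp add: abs_mult)
      moreover have "c * f v - K * v - (c * f u - K * u) = c * (f v - f u) - K * (v - u)"
        by (simp add: algebra_simps)
      moreover have "\<bar>c * (f v - f u)\<bar> = \<bar>f v - f u\<bar>" using c by (auto simp: abs_mult)
      ultimately show "norm (c * f v - K * v - (c * f u - K * u)) \<le> norm (f v - f u) + \<bar>K\<bar> * (v - u)"
        using abs_triangle_ineq4[of "c * (f v - f u)" "K * (v - u)"] by simp
    qed simp
    fix t assume "t \<in> {a<..<b} - E"
    then obtain D where D: "(f has_real_derivative D) (at t)" "\<bar>D\<bar> \<le> K" using deriv by blast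
    have "((\<lambda>t. c * f t - K * t) has_real_derivative c * D - K) (at t)"
      by (auto intro!: derivative_eq_intros D(1))
    moreover have "c * D - K \<le> 0" using D(2) c by auto
    ultimately show "\<exists>D\<le>0. ((\<lambda>t. c * f t - K * t) has_real_derivative D) (at t)" by blast
  qed
  show ?thesis using le[of 1] le[of "-1"] by (simp add: algebra_simps abs_le_iff)
qed

lemma exp_decay_lipschitz:
  fixes l :: real
  assumes "l \<ge> 0" "t0 \<le> u" "u \<le> v"
  shows "\<bar>exp (- l * (v - t0)) - exp (- l * (u - t0))\<bar> \<le> l * (v - u)"
proof -
  let ?E = "\<lambda>t. exp (- l * (t - t0))"
  have "?E v = ?E u * exp (- (l * (v - u)))"
    by (simp add: exp_add[symmetric] algebra_simps)
  then have eq: "?E u - ?E v = ?E u * (1 - exp (- (l * (v - u))))"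
    by (simp add: algebra_simps)
  have "1 - exp (- (l * (v - u))) \<le> l * (v - u)"
    using exp_ge_add_one_self[of "- (l * (v - u))"] by simp
  moreover have "0 \<le> 1 - exp (- (l * (v - u)))" using assms by simp
  moreover have "0 \<le> ?E u" "?E u \<le> 1" using assms by auto
  ultimately have "0 \<le> ?E u - ?E v" "?E u - ?E v \<le> l * (v - u)"
    unfolding eq by (auto intro: mult_nonneg_nonneg order_trans[OF mult_left_le_one_le])
  then show ?thesis by simp
qed

text \<open>Comparison of \<open>x\<close> with the curve \<open>c * exp (- l * (t - t0))\<close>. The condition on \<open>F\<close> makes this curve
  a supersolution of \<open>x' = p x + f\<close> for every \<open>p \<le> - \<alpha>\<close>. After the last time \<open>s\<close> at which \<open>x\<close> does not
  exceed the curve, the difference would therefore be nonincreasing, and \<open>x\<close> could not end above it.\<close>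

lemma exp_decay_comparison_upper:
  fixes x :: "real \<Rightarrow> real"
  assumes "t0 \<le> T" and ac: "abs_cont_on t0 T x" and Z: "negligible Z"
    and l: "l \<ge> 0" and c: "c \<ge> 0" "x t0 \<le> c" and F: "F \<le> (\<alpha> - l) * c" and \<alpha>: "\<alpha> \<ge> 0"
    and deriv: "\<And>t. t \<in> {t0<..<T} - Z \<Longrightarrow> \<exists>p f. (x has_real_derivative p * x t + f) (at t) \<and>
       p \<le> - \<alpha> \<and> f \<le> F * exp (- l * (t - t0))"
  shows "x T \<le> c * exp (- l * (T - t0))"
proof (rule ccontr)
  define E where "E t = exp (- l * (t - t0))" for t
  assume "\<not> x T \<le> c * exp (- l * (T - t0))"
  then have T: "x T > c * E T" by (simp add: E_def)
  define S where "S = {t \<in> {t0..T}. x t - c * E t \<le> 0}"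
  have cont: "continuous_on {t0..T} (\<lambda>t. x t - c * E t)"
    unfolding E_def by (intro continuous_intros abs_cont_on_imp_continuous_on[OF ac])
  have "S = {t0..T} \<inter> (\<lambda>t. x t - c * E t) -` {..0}" by (auto simp: S_def)
  then have "closed S" using continuous_closed_preimage[OF cont, of "{..0}"] by simp
  moreover have "bounded S"
    by (rule bounded_subset[OF bounded_closed_interval[of t0 T]]) (auto simp: S_def)
  ultimately have "compact S" by (simp add: compact_eq_bounded_closed)
  moreover have "t0 \<in> S" using c \<open>t0 \<le> T\<close> by (simp add: S_def E_def)
  ultimately obtain s where s: "s \<in> S" "\<And>t. t \<in> S \<Longrightarrow> t \<le> s"
    using compact_attains_sup[of S] by blast
  have "x T - c * E T \<le> x s - c * E s"
  proof (rule abs_cont_on_deriv_nonpos_imp_le[OF _ _ Z, where f = "\<lambda>t. x t - c * E t"])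
    show "s \<le> T" using s(1) by (simp add: S_def)
    show "abs_cont_on s T (\<lambda>t. x t - c * E t)"
    proof (rule abs_cont_on_dist_le[OF abs_cont_on_subinterval[OF ac], of s T "c * l"])
      fix u v assume uv: "s \<le> u" "u \<le> v" "v \<le> T"
      have "\<bar>E v - E u\<bar> \<le> l * (v - u)"
        unfolding E_def using s(1) uv l by (intro exp_decay_lipschitz) (auto simp: S_def)
      then have "c * \<bar>E v - E u\<bar> \<le> c * (l * (v - u))" using c by (intro mult_left_mono)
      moreover have "\<bar>c * (E v - E u)\<bar> = c * \<bar>E v - E u\<bar>" using c by (simp add: abs_mult)
      ultimately show "norm (x v - c * E v - (x u - c * E u)) \<le> norm (x v - x u) + c * l * (v - u)"
        using abs_triangle_ineq4[of "x v - x u" "c * (E v - E u)"] by (simp add: algebra_simps)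
    qed (use s(1) c l in \<open>auto simp: S_def\<close>)
    fix t assume t: "t \<in> {s<..<T} - Z"
    then have "t \<in> {t0<..<T} - Z" using s(1) by (auto simp: S_def)
    then obtain p f where pf: "(x has_real_derivative p * x t + f) (at t)" "p \<le> - \<alpha>" "f \<le> F * E t"
      using deriv E_def by metis
    have E0: "E t > 0" by (simp add: E_def)
    have "x t > c * E t"
      using s(2)[of t] t s(1) by (force simp: S_def)
    moreover have "0 \<le> c * E t" using c E0 by simp
    ultimately have "p * x t \<le> - \<alpha> * x t" and "\<alpha> * (c * E t) \<le> \<alpha> * x t"
      using mult_right_mono[OF pf(2), of "x t"] \<alpha> by (simp_all add: mult_left_mono)
    moreover have "F * E t \<le> (\<alpha> - l) * c * E t" using F E0 by (intro mult_right_mono) auto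
    ultimately have "p * x t + f + c * l * E t \<le> 0" using pf(3) by (simp add: algebra_simps)
    moreover have "((\<lambda>t. x t - c * E t) has_real_derivative p * x t + f + c * l * E t) (at t)"
      unfolding E_def by (auto intro!: derivative_eq_intros pf(1))
    ultimately show "\<exists>D\<le>0. ((\<lambda>t. x t - c * E t) has_real_derivative D) (at t)" by blast
  qed
  then show False using T s(1) by (simp add: S_def)
qed

lemma exp_decay_comparison:
  fixes x :: "real \<Rightarrow> real"
  assumes "t0 \<le> T" and ac: "abs_cont_on t0 T x" and Z: "negligible Z"
    and l: "l \<ge> 0" and c: "\<bar>x t0\<bar> \<le> c" and F: "F \<le> (\<alpha> - l) * c" and \<alpha>: "\<alpha> \<ge> 0"
    and deriv: "\<And>t. t \<in> {t0<..<T} - Z \<Longrightarrow> \<exists>p f. (x has_real_derivative p * x t + f) (at t) \<and>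
       p \<le> - \<alpha> \<and> \<bar>f\<bar> \<le> F * exp (- l * (t - t0))"
  shows "\<bar>x T\<bar> \<le> c * exp (- l * (T - t0))"
proof -
  have "x T \<le> c * exp (- l * (T - t0))"
    using assms by (intro exp_decay_comparison_upper[OF assms(1) ac Z l _ _ F \<alpha>]) (fastforce dest: deriv)+
  moreover have "- x T \<le> c * exp (- l * (T - t0))"
  proof (rule exp_decay_comparison_upper[OF assms(1) _ Z l _ _ F \<alpha>])
    show "abs_cont_on t0 T (\<lambda>t. - x t)"
      by (rule abs_cont_on_dist_le[OF ac, of 0]) (auto simp: norm_minus_commute)
    fix t assume "t \<in> {t0<..<T} - Z"
    then obtain p f where pf: "(x has_real_derivative p * x t + f) (at t)" "p \<le> - \<alpha>"
      "\<bar>f\<bar> \<le> F * exp (- l * (t - t0))" using deriv by blast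
    have "((\<lambda>t. - x t) has_real_derivative p * (- x t) + (- f)) (at t)"
      by (auto intro!: derivative_eq_intros pf(1))
    then show "\<exists>p f. ((\<lambda>t. - x t) has_real_derivative p * (- x t) + f) (at t) \<and>
       p \<le> - \<alpha> \<and> f \<le> F * exp (- l * (t - t0))"
      using pf(2,3) by (intro exI[of _ p] exI[of _ "- f"]) auto
  qed (use c in auto)
  ultimately show ?thesis by (simp add: abs_le_iff)
qed

section \<open>Estimates along a trajectory\<close>

text \<open>One trajectory together with a single null set \<open>Z\<close> outside which the equation and all bounds
  on the coefficients and delays hold; \<open>r\<close> bounds all delays.\<close>

locale delay_trajectory =
  fixes a g :: "'m::finite \<Rightarrow> 'm \<Rightarrow> real \<Rightarrow> real"
    and \<alpha> A :: "'m \<Rightarrow> real"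
    and B s :: "'m \<Rightarrow> 'm \<Rightarrow> real"
    and r t0 :: real
    and X :: "real \<Rightarrow> real^'m"
    and Z :: "real set"
  assumes negl: "negligible Z"
    and \<alpha>_pos: "\<And>i. 0 < \<alpha> i" and A_nonneg: "\<And>i. 0 \<le> A i"
    and B_nonneg: "\<And>i j. i \<noteq> j \<Longrightarrow> 0 \<le> B i j"
    and s_nonneg: "\<And>i j. 0 \<le> s i j" and s_le: "\<And>i j. s i j \<le> r"
    and ac: "locally_abs_cont_from t0 X"
    and deriv: "\<And>t i. t > t0 \<Longrightarrow> t \<notin> Z \<Longrightarrow>
      ((\<lambda>u. X u $ i) has_real_derivative (\<Sum>j\<in>UNIV. a i j t * X (g i j t) $ j)) (at t)"
    and diag: "\<And>t i. t > t0 \<Longrightarrow> t \<notin> Z \<Longrightarrow> \<alpha> i \<le> - a i i t \<and> - a i i t \<le> A i"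
    and offdiag: "\<And>t i j. t > t0 \<Longrightarrow> t \<notin> Z \<Longrightarrow> i \<noteq> j \<Longrightarrow> \<bar>a i j t\<bar> \<le> B i j"
    and delay: "\<And>t i j. t > t0 \<Longrightarrow> t \<notin> Z \<Longrightarrow> 0 \<le> t - g i j t \<and> t - g i j t \<le> s i j"
begin

lemma r_nonneg: "0 \<le> r"
  using s_nonneg s_le order_trans by blast

lemma abs_cont_component:
  assumes "t0 \<le> u" "u \<le> v"
  shows "abs_cont_on u v (\<lambda>t. X t $ i)"
proof -
  have "abs_cont_on t0 (v + 1) X"
    using ac assms by (simp add: locally_abs_cont_from_def)
  then have "abs_cont_on t0 (v + 1) (\<lambda>t. X t $ i)"
    by (rule abs_cont_on_dist_le[of _ _ _ 0])
       (auto simp flip: vector_minus_component intro: component_le_norm_cart)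
  then show ?thesis by (rule abs_cont_on_subinterval) (use assms in auto)
qed

text \<open>The factor of \<open>exp (- l * (t - t0))\<close> in the bound of the derivative of component \<open>i\<close> that results if
  every component \<open>j\<close> is at most \<open>W j * exp (- l * (t - t0))\<close>. Evaluating at a delayed time costs the
  factor \<open>exp (l * r)\<close>.\<close>

definition speed :: "real \<Rightarrow> ('m \<Rightarrow> real) \<Rightarrow> 'm \<Rightarrow> real" where
  "speed l W i = exp (l * r) * (A i * W i + (\<Sum>j\<in>UNIV - {i}. B i j * W j))"

text \<open>The exponential bound with weights \<open>W\<close> is assumed up to time \<open>T\<close> and improved from the equation; that it
  holds for some \<open>W\<close> follows from continuity on a compact interval.\<close>

context
  fixes l T I :: real and W :: "'m \<Rightarrow> real"
  assumes l: "l \<ge> 0" and I: "I \<ge> 0" and W: "\<And>j. W j \<ge> 0"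
    and init: "\<And>t j. t0 - r \<le> t \<Longrightarrow> t \<le> t0 \<Longrightarrow> \<bar>X t $ j\<bar> \<le> I"
    and bound: "\<And>t j. t0 - r \<le> t \<Longrightarrow> t \<le> T \<Longrightarrow> \<bar>X t $ j\<bar> \<le> W j * exp (- l * (t - t0))"
begin

lemma speed_nonneg: "speed l W i \<ge> 0"
  unfolding speed_def using A_nonneg B_nonneg W
  by (intro mult_nonneg_nonneg add_nonneg_nonneg sum_nonneg) auto

lemma exp_decay_shift:
  assumes "u \<ge> t - r"
  shows "exp (- l * (u - t0)) \<le> exp (l * r) * exp (- l * (t - t0))"
proof -
  have "l * (t - r) \<le> l * u" using assms l by (rule mult_left_mono)
  then show ?thesis by (simp add: exp_add[symmetric] algebra_simps)
qed

lemma delayed_bound: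
  assumes "t0 < t" "t \<le> T" "t \<notin> Z"
  shows "\<bar>X (g i j t) $ j\<bar> \<le> W j * (exp (l * r) * exp (- l * (t - t0)))"
proof -
  have g: "t - s i j \<le> g i j t" "g i j t \<le> t" using delay[of t i j] assms by auto
  then have "\<bar>X (g i j t) $ j\<bar> \<le> W j * exp (- l * (g i j t - t0))"
    using assms s_le[of i j] by (intro bound) auto
  also have "\<dots> \<le> W j * (exp (l * r) * exp (- l * (t - t0)))"
    using g s_le[of i j] W by (intro mult_left_mono exp_decay_shift) auto
  finally show ?thesis .
qed

lemma offdiag_bound:
  assumes "t0 < t" "t \<le> T" "t \<notin> Z"
  shows "\<bar>\<Sum>j\<in>UNIV - {i}. a i j t * X (g i j t) $ j\<bar>
    \<le> exp (l * r) * (\<Sum>j\<in>UNIV - {i}. B i j * W j) * exp (- l * (t - t0))"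
proof -
  have "\<bar>\<Sum>j\<in>UNIV - {i}. a i j t * X (g i j t) $ j\<bar>
      \<le> (\<Sum>j\<in>UNIV - {i}. B i j * (W j * (exp (l * r) * exp (- l * (t - t0)))))"
    using assms delayed_bound offdiag B_nonneg
    by (intro order_trans[OF sum_abs] sum_mono) (auto simp: abs_mult intro!: mult_mono)
  then show ?thesis by (simp add: sum_distrib_left sum_distrib_right mult_ac)
qed

lemma rhs_split:
  "(\<Sum>j\<in>UNIV. a i j t * X (g i j t) $ j)
    = a i i t * X (g i i t) $ i + (\<Sum>j\<in>UNIV - {i}. a i j t * X (g i j t) $ j)"
  by (rule sum.remove) auto

lemma rhs_bound:
  assumes "t0 < t" "t \<le> T" "t \<notin> Z"
  shows "\<bar>\<Sum>j\<in>UNIV. a i j t * X (g i j t) $ j\<bar> \<le> speed l W i * exp (- l * (t - t0))"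
proof -
  have "\<bar>a i i t\<bar> \<le> A i" using diag[of t i] \<alpha>_pos[of i] assms by auto
  then have "\<bar>a i i t * X (g i i t) $ i\<bar> \<le> A i * (W i * (exp (l * r) * exp (- l * (t - t0))))"
    unfolding abs_mult using A_nonneg assms by (intro mult_mono delayed_bound) auto
  then show ?thesis
    using offdiag_bound[OF assms, of i] unfolding rhs_split speed_def
    by (simp add: algebra_simps)
qed

lemma increment_bound:
  assumes "t0 \<le> u" "u \<le> t" "t \<le> T"
  shows "\<bar>X t $ i - X u $ i\<bar> \<le> speed l W i * exp (- l * (u - t0)) * (t - u)"
proof (rule abs_cont_on_deriv_bounded_imp_dist_le[OF \<open>u \<le> t\<close> _ negl])
  show "abs_cont_on u t (\<lambda>t. X t $ i)" using assms by (intro abs_cont_component)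
  fix v assume v: "v \<in> {u<..<t} - Z"
  have "l * u \<le> l * v" using v l by (intro mult_left_mono) auto
  then have "speed l W i * exp (- l * (v - t0)) \<le> speed l W i * exp (- l * (u - t0))"
    using speed_nonneg by (intro mult_left_mono) (auto simp: algebra_simps)
  then show "\<exists>D. ((\<lambda>t. X t $ i) has_real_derivative D) (at v) \<and> \<bar>D\<bar> \<le> speed l W i * exp (- l * (u - t0))"
    using deriv[of v i] rhs_bound[of v i] v assms
    by (intro exI[of _ "\<Sum>j\<in>UNIV. a i j v * X (g i j v) $ j"]) auto
qed

text \<open>Replacing \<open>X (g i i t) $ i\<close> by \<open>X t $ i\<close> costs at most the derivative bound times the delay as long as
  the delayed time is past \<open>t0\<close>. Otherwise the equation says nothing about the part before \<open>t0\<close>, and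
  the oscillation \<open>2 * I\<close> of the initial data is added.\<close>

lemma diagonal_delay_error:
  assumes "t0 < t" "t \<le> T" "t \<notin> Z"
  shows "\<bar>X (g i i t) $ i - X t $ i\<bar>
    \<le> exp (l * r) * (s i i * speed l W i + 2 * I) * exp (- l * (t - t0))"
proof -
  let ?E = "exp (- l * (t - t0))"
  define m where "m = max (g i i t) t0"
  have g: "t - s i i \<le> g i i t" "g i i t \<le> t" using delay[of t i i] assms by auto
  have m: "t0 \<le> m" "m \<le> t" "t - m \<le> s i i" using g assms by (auto simp: m_def)
  have "\<bar>X t $ i - X m $ i\<bar> \<le> speed l W i * exp (- l * (m - t0)) * (t - m)"
    using m assms by (intro increment_bound)
  also have "\<dots> \<le> speed l W i * (exp (l * r) * ?E) * s i i"
    using m s_le[of i i] speed_nonneg s_nonneg by (intro mult_mono exp_decay_shift mult_nonneg_nonneg) auto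
  finally have 1: "\<bar>X t $ i - X m $ i\<bar> \<le> exp (l * r) * (s i i * speed l W i) * ?E"
    by (simp add: mult_ac)
  have 2: "\<bar>X (g i i t) $ i - X m $ i\<bar> \<le> exp (l * r) * (2 * I) * ?E"
  proof (cases "g i i t < t0")
    case True
    then have "m = t0" by (simp add: m_def)
    then have "\<bar>X (g i i t) $ i - X m $ i\<bar> \<le> 2 * I * 1"
      using init[of "g i i t" i] init[of t0 i] True g s_le[of i i] r_nonneg assms by auto
    also have "\<dots> \<le> 2 * I * (exp (l * r) * ?E)"
      using exp_decay_shift[of t t0] True g s_le[of i i] I by (intro mult_left_mono) auto
    finally show ?thesis by (simp add: mult_ac)
  next
    case False
    then show ?thesis using I by (simp add: m_def)
  qed
  show ?thesis using 1 2 by (simp add: algebra_simps)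
qed

text \<open>With the delay error moved to the inhomogeneity, the equation for component \<open>i\<close> reads
  \<open>x' = a i i t * x + f\<close> without delay in the dissipative term, and the scalar comparison applies.\<close>

lemma component_bound:
  assumes "t0 \<le> t" "t \<le> T" "I \<le> c"
    and c: "A i * (exp (l * r) * (s i i * speed l W i + 2 * I)) + exp (l * r) * (\<Sum>j\<in>UNIV - {i}. B i j * W j)
      \<le> (\<alpha> i - l) * c"
  shows "\<bar>X t $ i\<bar> \<le> c * exp (- l * (t - t0))"
proof (rule exp_decay_comparison[OF \<open>t0 \<le> t\<close> abs_cont_component negl l _ c])
  show "\<bar>X t0 $ i\<bar> \<le> c" using init[of t0 i] r_nonneg assms(3) by auto
  show "0 \<le> \<alpha> i" using \<alpha>_pos[of i] by simp
  fix u assume "u \<in> {t0<..<t} - Z"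
  then have u: "t0 < u" "u \<le> T" "u \<notin> Z" using assms by auto
  let ?E = "exp (- l * (u - t0))" and ?S = "\<Sum>j\<in>UNIV - {i}. a i j u * X (g i j u) $ j"
  define f where "f = a i i u * (X (g i i u) $ i - X u $ i) + ?S"
  have "\<bar>a i i u\<bar> \<le> A i" using diag[of u i] \<alpha>_pos[of i] u by auto
  then have "\<bar>a i i u * (X (g i i u) $ i - X u $ i)\<bar>
      \<le> A i * (exp (l * r) * (s i i * speed l W i + 2 * I) * ?E)"
    unfolding abs_mult using A_nonneg u by (intro mult_mono diagonal_delay_error) auto
  then have "\<bar>f\<bar> \<le> (A i * (exp (l * r) * (s i i * speed l W i + 2 * I))
      + exp (l * r) * (\<Sum>j\<in>UNIV - {i}. B i j * W j)) * ?E"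
    using offdiag_bound[OF u, of i] unfolding f_def by (simp add: algebra_simps)
  moreover have "((\<lambda>t. X t $ i) has_real_derivative a i i u * X u $ i + f) (at u)"
    using deriv[OF u(1,3), of i] unfolding rhs_split f_def by (simp add: algebra_simps)
  ultimately show "\<exists>p f. ((\<lambda>t. X t $ i) has_real_derivative p * X u $ i + f) (at u) \<and> p \<le> - \<alpha> i \<and>
      \<bar>f\<bar> \<le> (A i * (exp (l * r) * (s i i * speed l W i + 2 * I))
        + exp (l * r) * (\<Sum>j\<in>UNIV - {i}. B i j * W j)) * ?E"
    using diag[OF u(1,3), of i] by (intro exI[of _ "a i i u"] exI[of _ f]) auto
qed (use assms in auto)

end

end

section \<open>Absorption by a weighted maximum\<close>

text \<open>The slack in row \<open>i\<close> of the comparison argument for the weights \<open>v\<close> and the rate \<open>l\<close>. For \<open>l = 0\<close> it is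
  \<open>\<alpha> i\<close> times the entry \<open>i\<close> of the comparison matrix applied to \<open>v\<close>.\<close>

definition margin ::
  "('m::finite \<Rightarrow> real) \<Rightarrow> ('m \<Rightarrow> real) \<Rightarrow> ('m \<Rightarrow> 'm \<Rightarrow> real) \<Rightarrow> ('m \<Rightarrow> 'm \<Rightarrow> real) \<Rightarrow> real \<Rightarrow>
    ('m \<Rightarrow> real) \<Rightarrow> real \<Rightarrow> 'm \<Rightarrow> real" where
  "margin \<alpha> A B s r v l i =
    (\<alpha> i - l) * v i
    - A i * (exp (l * r) * (s i i * (exp (l * r) * (A i * v i + (\<Sum>j\<in>UNIV - {i}. B i j * v j)))))
    - exp (l * r) * (\<Sum>j\<in>UNIV - {i}. B i j * v j)"

context delay_trajectory
begin

lemma continuous_on_history: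
  assumes "continuous_on {t0 - r..t0} X" "t0 \<le> T"
  shows "continuous_on {t0 - r..T} X"
proof -
  have "abs_cont_on t0 (T + 1) X"
    using ac assms(2) by (simp add: locally_abs_cont_from_def)
  then have "continuous_on {t0..T} X"
    by (rule continuous_on_subset[OF abs_cont_on_imp_continuous_on]) auto
  then have "continuous_on ({t0 - r..t0} \<union> {t0..T}) X"
    using assms(1) by (intro continuous_on_closed_Un) auto
  moreover have "{t0 - r..t0} \<union> {t0..T} = {t0 - r..T}"
    using assms(2) r_nonneg by (auto simp: ivl_disj_un)
  ultimately show ?thesis by simp
qed

text \<open>Let \<open>U\<close> be the maximum of \<open>\<bar>X t $ j\<bar> / (v j * exp (- l * (t - t0)))\<close> over all components and all times up to \<open>T\<close>,
  attained at component \<open>k\<close>. If it is attained during the initial interval, it is controlled by the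
  initial data. Otherwise \<open>component_bound\<close> with the weights \<open>U * v j\<close> bounds \<open>U\<close> by a fraction of itself
  plus a multiple of the initial data, and the positive margin allows \<open>U\<close> to be absorbed. The resulting
  constant depends neither on \<open>T\<close> nor on \<open>t0\<close>.\<close>

lemma weighted_exponential_bound:
  assumes l: "l \<ge> 0" and v: "\<And>j. v j > 0" and marg: "\<And>i. margin \<alpha> A B s r v l i > 0"
    and cont: "continuous_on {t0 - r..t0} X" and I: "I \<ge> 0"
    and init: "\<And>t j. t0 - r \<le> t \<Longrightarrow> t \<le> t0 \<Longrightarrow> \<bar>X t $ j\<bar> \<le> I"
    and T: "t0 \<le> T"
  shows "\<bar>X T $ i\<bar> \<le>
    (\<Sum>k\<in>UNIV. 1 / v k + 2 * A k * exp (l * r) / margin \<alpha> A B s r v l k) * I * v i * exp (- l * (T - t0))"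
proof -
  let ?m = "margin \<alpha> A B s r v l"
  define K where "K = (\<Sum>k\<in>UNIV. 1 / v k + 2 * A k * exp (l * r) / ?m k)"
  define E where "E t = exp (- l * (t - t0))" for t
  have E: "E t > 0" for t by (simp add: E_def)
  define h where "h j t = \<bar>X t $ j\<bar> / (v j * E t)" for j t
  have "\<exists>\<tau>\<in>{t0 - r..T}. \<forall>t\<in>{t0 - r..T}. h j t \<le> h j \<tau>" for j
  proof (rule continuous_attains_sup)
    show "continuous_on {t0 - r..T} (h j)"
      unfolding h_def E_def using v[of j]
      by (intro continuous_intros continuous_on_component continuous_on_history[OF cont T]) auto
  qed (use T r_nonneg in auto)
  then obtain \<tau> where \<tau>: "\<And>j. \<tau> j \<in> {t0 - r..T}" "\<And>j t. t \<in> {t0 - r..T} \<Longrightarrow> h j t \<le> h j (\<tau> j)"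
    by metis
  define U where "U = Max (range (\<lambda>j. h j (\<tau> j)))"
  have "U \<in> range (\<lambda>j. h j (\<tau> j))" unfolding U_def by (rule Max_in) auto
  then obtain k where k: "U = h k (\<tau> k)" by blast
  have U_ge: "h j t \<le> U" if "t \<in> {t0 - r..T}" for j t
    unfolding U_def using \<tau>(2)[OF that, of j] by (rule order_trans) (auto intro: Max_ge)
  have U0: "U \<ge> 0" unfolding k h_def using v[of k] E by (simp add: less_imp_le)
  have bound: "\<bar>X t $ j\<bar> \<le> U * v j * E t" if "t0 - r \<le> t" "t \<le> T" for t j
    using U_ge[of t j] that v[of j] E[of t] unfolding h_def
    by (simp add: pos_divide_le_eq mult_ac)
  have "1 / v k + 2 * A k * exp (l * r) / ?m k \<le> K"
    unfolding K_def
  proof (rule member_le_sum)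
    show "0 \<le> 1 / v j + 2 * A j * exp (l * r) / ?m j" for j
      using v[of j] A_nonneg[of j] marg[of j] by (intro add_nonneg_nonneg) auto
  qed auto
  then have "(1 / v k + 2 * A k * exp (l * r) / ?m k) * I \<le> K * I"
    using I by (rule mult_right_mono)
  then have K_ge: "I / v k + 2 * A k * exp (l * r) * I / ?m k \<le> K * I"
    by (simp add: algebra_simps)
  have terms: "I / v k \<ge> 0" "2 * A k * exp (l * r) * I / ?m k \<ge> 0"
    using I A_nonneg[of k] v[of k] marg[of k] by auto
  have UX: "\<bar>X (\<tau> k) $ k\<bar> = U * v k * E (\<tau> k)"
    using v[of k] E[of "\<tau> k"] by (simp add: k h_def)
  have "U * v k \<le> I \<or> U * ?m k \<le> 2 * A k * exp (l * r) * I"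
  proof (cases "\<tau> k \<le> t0")
    case True
    have "l * (\<tau> k - t0) \<le> 0" using True l by (simp add: mult_nonneg_nonpos)
    then have "1 \<le> E (\<tau> k)" by (simp add: E_def)
    then have "U * v k * 1 \<le> U * v k * E (\<tau> k)"
      using U0 v[of k] by (intro mult_left_mono) auto
    also have "\<dots> \<le> I" using init[of "\<tau> k" k] True \<tau>(1)[of k] UX by simp
    finally show ?thesis by simp
  next
    case False
    define b where "b = (\<Sum>j\<in>UNIV - {k}. B k j * v j)"
    define w where "w = A k * (exp (l * r) * (s k k * (exp (l * r) * (A k * v k + b)))) + exp (l * r) * b"
    have m_eq: "?m k = (\<alpha> k - l) * v k - w" by (simp add: margin_def w_def b_def)
    have "b \<ge> 0" unfolding b_def using B_nonneg v by (intro sum_nonneg mult_nonneg_nonneg) (auto intro: less_imp_le)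
    then have "w \<ge> 0" unfolding w_def using A_nonneg[of k] v[of k] s_nonneg[of k k] by simp
    then have "(\<alpha> k - l) * v k > 0" using marg[of k] m_eq by simp
    then have \<alpha>l: "\<alpha> k - l > 0" using v[of k] by (simp add: zero_less_mult_iff)
    define F where "F = w * U + 2 * A k * exp (l * r) * I"
    define c where "c = max I (F / (\<alpha> k - l))"
    have sumU: "(\<Sum>j\<in>UNIV - {k}. B k j * (U * v j)) = U * b"
      by (simp add: b_def sum_distrib_left mult_ac)
    have "\<bar>X (\<tau> k) $ k\<bar> \<le> c * exp (- l * (\<tau> k - t0))"
    proof (rule component_bound[where W = "\<lambda>j. U * v j" and T = T, OF l I])
      have "A k * (exp (l * r) * (s k k * speed l (\<lambda>j. U * v j) k + 2 * I))
          + exp (l * r) * (\<Sum>j\<in>UNIV - {k}. B k j * (U * v j)) = F"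
        unfolding speed_def sumU F_def w_def by (simp add: algebra_simps)
      moreover have "F / (\<alpha> k - l) \<le> c" by (simp add: c_def)
      then have "F \<le> (\<alpha> k - l) * c" using \<alpha>l by (simp add: pos_divide_le_eq mult.commute)
      ultimately show "A k * (exp (l * r) * (s k k * speed l (\<lambda>j. U * v j) k + 2 * I))
          + exp (l * r) * (\<Sum>j\<in>UNIV - {k}. B k j * (U * v j)) \<le> (\<alpha> k - l) * c" by simp
    qed (use bound init False \<tau>(1)[of k] U0 v in \<open>auto simp: c_def E_def less_imp_le\<close>)
    then have "U * v k \<le> c" using UX E[of "\<tau> k"] unfolding E_def[symmetric] by simp
    then consider "U * v k \<le> I" | "U * v k \<le> F / (\<alpha> k - l)" by (auto simp: c_def max_def split: if_splits)
    then show ?thesis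
    proof cases
      case 2
      then have "U * v k * (\<alpha> k - l) \<le> F" using \<alpha>l by (simp add: pos_le_divide_eq)
      then show ?thesis by (simp add: m_eq F_def algebra_simps)
    qed simp
  qed
  then have "U \<le> K * I"
  proof
    assume "U * v k \<le> I"
    then have "U \<le> I / v k" using v[of k] by (simp add: pos_le_divide_eq)
    then show ?thesis using K_ge terms by linarith
  next
    assume "U * ?m k \<le> 2 * A k * exp (l * r) * I"
    then have "U \<le> 2 * A k * exp (l * r) * I / ?m k" using marg[of k] by (simp add: pos_le_divide_eq)
    then show ?thesis using K_ge terms by linarith
  qed
  then have "U * v i * E T \<le> K * I * v i * E T"
    using v[of i] E[of T] by (intro mult_right_mono) auto
  then show ?thesis
    using bound[of T i] T r_nonneg unfolding K_def E_def by linarith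
qed

end

text \<open>The margin depends continuously on the rate and is positive at rate \<open>0\<close>.\<close>

lemma exists_rate_with_positive_margin:
  fixes \<alpha> A :: "'m::finite \<Rightarrow> real"
  assumes \<alpha>: "\<And>i. 0 < \<alpha> i"
    and D: "\<And>i. (comparison_matrix \<alpha> A B s *v v) $ i > 0"
  obtains l where "l > 0" "\<And>i. margin \<alpha> A B s r (($) v) l i > 0"
proof -
  have "eventually (\<lambda>l. margin \<alpha> A B s r (($) v) l i > 0) (at_right 0)" for i
  proof -
    let ?C = "comparison_matrix \<alpha> A B s"
    define b where "b = (\<Sum>j\<in>UNIV - {i}. B i j * v $ j)"
    have "(?C *v v) $ i = (\<Sum>j\<in>UNIV. ?C $ i $ j * v $ j)"
      by (simp add: matrix_vector_mult_def)
    also have "\<dots> = ?C $ i $ i * v $ i + (\<Sum>j\<in>UNIV - {i}. ?C $ i $ j * v $ j)"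
      by (rule sum.remove) auto
    also have "(\<Sum>j\<in>UNIV - {i}. ?C $ i $ j * v $ j)
        = (\<Sum>j\<in>UNIV - {i}. - ((A i * s i i + 1) / \<alpha> i) * (B i j * v $ j))"
      by (intro sum.cong) (auto simp: comparison_matrix_def field_simps)
    also have "\<dots> = - ((A i * s i i + 1) / \<alpha> i) * b"
      unfolding b_def sum_distrib_left ..
    also have "?C $ i $ i = 1 - (A i)\<^sup>2 * s i i / \<alpha> i"
      by (simp add: comparison_matrix_def)
    finally have Cv: "(?C *v v) $ i
        = (1 - (A i)\<^sup>2 * s i i / \<alpha> i) * v $ i + - ((A i * s i i + 1) / \<alpha> i) * b" .
    have "\<alpha> i * (?C *v v) $ i = \<alpha> i * v $ i - (A i)\<^sup>2 * s i i * v $ i - (A i * s i i + 1) * b"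
      unfolding Cv using \<alpha>[of i] by (simp add: field_simps)
    moreover have "margin \<alpha> A B s r (($) v) 0 i
        = \<alpha> i * v $ i - (A i)\<^sup>2 * s i i * v $ i - (A i * s i i + 1) * b"
      unfolding margin_def b_def[symmetric] by (simp add: power2_eq_square algebra_simps)
    ultimately have "margin \<alpha> A B s r (($) v) 0 i = \<alpha> i * (?C *v v) $ i" by simp
    then have "margin \<alpha> A B s r (($) v) 0 i > 0" using \<alpha> D by simp
    moreover have "((\<lambda>l. margin \<alpha> A B s r (($) v) l i) \<longlongrightarrow> margin \<alpha> A B s r (($) v) 0 i) (at_right 0)"
      unfolding margin_def by (intro tendsto_intros)
    ultimately show ?thesis by (simp add: order_tendstoD(1))
  qed
  then have "eventually (\<lambda>l. \<forall>i. margin \<alpha> A B s r (($) v) l i > 0) (at_right 0)"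
    by (simp add: eventually_all_finite)
  then have "eventually (\<lambda>l. l > 0 \<and> (\<forall>i. margin \<alpha> A B s r (($) v) l i > 0)) (at_right 0)"
    using eventually_at_right_less[of "0::real"] by (rule eventually_conj[rotated])
  then have "\<exists>l. l > 0 \<and> (\<forall>i. margin \<alpha> A B s r (($) v) l i > 0)"
    by (rule eventually_happens'[rotated]) simp
  then show thesis using that by blast
qed


section \<open>Arbitrary norms\<close>

lemma is_norm_le_sum:
  fixes N :: "real^'m::finite \<Rightarrow> real"
  assumes "is_norm N"
  shows "N x \<le> (\<Sum>i\<in>UNIV. \<bar>x $ i\<bar> * N (axis i 1))"
proof -
  have sub: "N (sum f S) \<le> (\<Sum>i\<in>S. N (f i))" if "finite S" for f :: "'m \<Rightarrow> real^'m" and S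
    using that
  proof (induction S)
    case empty
    have "N 0 = 0" using assms unfolding is_norm_def by blast
    then show ?case by simp
  next
    case (insert i S)
    have "N (f i + sum f S) \<le> N (f i) + N (sum f S)" using assms by (simp add: is_norm_def)
    then show ?case using insert by simp
  qed
  have "N x = N (\<Sum>i\<in>UNIV. x $ i *\<^sub>R axis i 1)"
    using basis_expansion[of x] by (simp add: scalar_mult_eq_scaleR)
  also have "\<dots> \<le> (\<Sum>i\<in>UNIV. N (x $ i *\<^sub>R axis i 1))" by (rule sub) simp
  also have "\<dots> = (\<Sum>i\<in>UNIV. \<bar>x $ i\<bar> * N (axis i 1))" using assms by (simp add: is_norm_def)
  finally show ?thesis .
qed

lemma is_norm_continuous_on:
  fixes N :: "real^'m::finite \<Rightarrow> real"
  assumes "is_norm N"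
  shows "continuous_on S N"
proof -
  define L where "L = (\<Sum>i\<in>UNIV. N (axis i 1 :: real^'m))"
  have L: "N x \<le> L * norm x" for x
  proof -
    have "N x \<le> (\<Sum>i\<in>UNIV. norm x * N (axis i 1))"
      using assms by (intro order_trans[OF is_norm_le_sum[OF assms]] sum_mono mult_right_mono component_le_norm_cart)
        (simp add: is_norm_def)
    then show ?thesis by (simp add: L_def sum_distrib_left mult.commute)
  qed
  have diff: "N x - N y \<le> L * norm (x - y)" for x y
  proof -
    have "N ((x - y) + y) \<le> N (x - y) + N y" using assms unfolding is_norm_def by blast
    then show ?thesis using L[of "x - y"] by simp
  qed
  have "L \<ge> 0" unfolding L_def using assms by (intro sum_nonneg) (simp add: is_norm_def)
  have "\<bar>N x - N y\<bar> \<le> L * norm (x - y)" for x y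
    using diff[of x y] diff[of y x] by (simp add: norm_minus_commute abs_le_iff)
  then have "L-lipschitz_on S N"
    using \<open>L \<ge> 0\<close> by (intro lipschitz_onI) (auto simp: dist_norm)
  then show ?thesis by (rule lipschitz_on_continuous_on)
qed

text \<open>The constant is the reciprocal of the minimum of \<open>N\<close> on the compact Euclidean unit sphere.\<close>

lemma is_norm_component_bound:
  fixes N :: "real^'m::finite \<Rightarrow> real"
  assumes "is_norm N"
  obtains C where "C > 0" "\<And>x i. \<bar>x $ i\<bar> \<le> C * N x"
proof -
  have "compact (sphere (0 :: real^'m) 1)" "sphere (0 :: real^'m) 1 \<noteq> {}" by auto
  then obtain e where e: "norm e = 1" "\<And>x. norm x = 1 \<Longrightarrow> N e \<le> N x"
    using continuous_attains_inf[OF _ _ is_norm_continuous_on[OF assms]] by (metis mem_sphere_0)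
  have "N e > 0" using e(1) assms unfolding is_norm_def
    by (metis less_eq_real_def norm_zero zero_neq_one)
  have "norm x \<le> (1 / N e) * N x" for x
  proof (cases "x = 0")
    case True
    then show ?thesis using assms by (simp add: is_norm_def)
  next
    case False
    then have "N e \<le> N ((1 / norm x) *\<^sub>R x)" by (intro e(2)) simp
    also have "\<dots> = N x / norm x" using assms by (simp add: is_norm_def)
    finally show ?thesis using False \<open>N e > 0\<close> by (simp add: field_simps)
  qed
  then have "\<bar>x $ i\<bar> \<le> (1 / N e) * N x" for x i
    using component_le_norm_cart[of x i] order_trans by blast
  then show thesis
    by (rule that[rotated]) (use \<open>N e > 0\<close> in simp)
qed

section \<open>Exponential stability\<close>

text \<open>An almost everywhere bound on the half-line is satisfied somewhere; this yields the signs of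
  \<open>A i\<close>, \<open>B i j\<close> and \<open>\<sigma> i j\<close> from the bounds that they occur in.\<close>

lemma AE_lebesgue_on_pos_ex:
  assumes "AE t in lebesgue_on {0::real..}. P t"
  shows "\<exists>t. P t"
proof (rule ccontr)
  assume "\<nexists>t. P t"
  then have "AE t in lebesgue. t \<notin> {0::real..}"
    using assms by (simp add: AE_restrict_space_iff)
  then obtain Z where "negligible Z" "{t. \<not> t \<notin> {0::real..}} \<subseteq> Z"
    unfolding eventually_ae_filter_negligible by blast
  then have "negligible {0::real..}" by (auto intro: negligible_subset)
  then have "negligible {0..1::real}" by (rule negligible_subset) auto
  then show False using negligible_interval(1)[of "0::real" 1] by simp
qed

lemma AE_lebesgue_on_imp_AE_future:
  assumes "AE t in lebesgue_on {0::real..}. P t" "0 \<le> t0"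
  shows "AE t in lebesgue. t > t0 \<longrightarrow> P t"
proof -
  have "AE t in lebesgue. t \<in> {0..} \<longrightarrow> P t"
    using assms(1) by (simp add: AE_restrict_space_iff)
  then show ?thesis by eventually_elim (use assms(2) in auto)
qed

theorem corollary3:
  fixes a g :: "'m::finite \<Rightarrow> 'm \<Rightarrow> real \<Rightarrow> real"
    and \<alpha> A :: "'m \<Rightarrow> real"
    and B \<sigma> :: "'m \<Rightarrow> 'm \<Rightarrow> real"
    and N :: "real^'m \<Rightarrow> real"
  assumes "is_norm N"
    and "\<And>i j. a i j \<in> borel_measurable (lebesgue_on {0..})"
    and "\<And>i j. \<exists>C. AE t in lebesgue_on {0..}. \<bar>a i j t\<bar> \<le> C"
    and "\<And>i. 0 < \<alpha> i"
    and "\<And>i. AE t in lebesgue_on {0..}. \<alpha> i \<le> - a i i t \<and> - a i i t \<le> A i"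
    and "\<And>i j. i \<noteq> j \<Longrightarrow> AE t in lebesgue_on {0..}. \<bar>a i j t\<bar> \<le> B i j"
    and "\<And>i j. g i j \<in> borel_measurable (lebesgue_on {0..})"
    and "\<And>i j. AE t in lebesgue_on {0..}. 0 \<le> t - g i j t \<and> t - g i j t \<le> \<sigma> i j"
    and "M_matrix (comparison_matrix \<alpha> A B \<sigma>)"
  shows "exponentially_stable N a g (Max {\<sigma> i j | i j. True})"
proof -
  note N = assms(1) and \<alpha> = assms(4) and diag = assms(5) and offdiag = assms(6) and delay = assms(8)
  define r where "r = Max {\<sigma> i j | i j. True}"
  have "{\<sigma> i j | i j. True} = range (\<lambda>(i, j). \<sigma> i j)" by auto
  then have "finite {\<sigma> i j | i j. True}" by simp
  then have \<sigma>_le: "\<sigma> i j \<le> r" for i j unfolding r_def by (rule Max_ge) auto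
  have \<sigma>_nonneg: "0 \<le> \<sigma> i j" for i j
    using AE_lebesgue_on_pos_ex[OF delay[of i j]] by auto
  have A_nonneg: "0 \<le> A i" for i
    using AE_lebesgue_on_pos_ex[OF diag[of i]] \<alpha>[of i] by auto
  have B_nonneg: "0 \<le> B i j" if "i \<noteq> j" for i j
    using AE_lebesgue_on_pos_ex[OF offdiag[OF that]] by (meson abs_ge_zero order_trans)
  obtain v where v: "\<And>i. v $ i > 0" "\<And>i. (comparison_matrix \<alpha> A B \<sigma> *v v) $ i > 0"
    using M_matrix_semipositive assms(9) by metis
  obtain l where l: "l > 0" "\<And>i. margin \<alpha> A B \<sigma> r (($) v) l i > 0"
    using exists_rate_with_positive_margin[OF \<alpha> v(2)] by metis
  obtain C where C: "C > 0" "\<And>x i. \<bar>x $ i\<bar> \<le> C * N x"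
    using is_norm_component_bound[OF N] by metis
  define K where "K = (\<Sum>k\<in>UNIV. 1 / v $ k + 2 * A k * exp (l * r) / margin \<alpha> A B \<sigma> r (($) v) l k)"
  define M where "M = (\<Sum>i\<in>UNIV. K * C * v $ i * N (axis i 1))"
  have N_nonneg: "N x \<ge> 0" for x using N by (simp add: is_norm_def)
  have estimate: "N (X t) \<le> M * exp (- l * (t - t0)) * (N (X t0) + sup_or_zero ((\<lambda>s. N (\<phi> s)) ` {t0 - r..<t0}))"
    if "t0 \<ge> 0" and \<phi>: "continuous_on {t0 - r..t0} \<phi>" and sol: "is_solution a g r t0 \<phi> X" and "t \<ge> t0"
    for t0 \<phi> X t
  proof -
    let ?J = "N (X t0) + sup_or_zero ((\<lambda>s. N (\<phi> s)) ` {t0 - r..<t0})"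
    define good where "good t \<longleftrightarrow>
        (\<forall>i. ((\<lambda>s. X s $ i) has_real_derivative (\<Sum>j\<in>UNIV. a i j t * X (g i j t) $ j)) (at t)) \<and>
        (\<forall>i. \<alpha> i \<le> - a i i t \<and> - a i i t \<le> A i) \<and> (\<forall>i j. i \<noteq> j \<longrightarrow> \<bar>a i j t\<bar> \<le> B i j) \<and>
        (\<forall>i j. 0 \<le> t - g i j t \<and> t - g i j t \<le> \<sigma> i j)" for t
    have "AE t in lebesgue. t > t0 \<longrightarrow>
        (\<forall>i. ((\<lambda>s. X s $ i) has_real_derivative (\<Sum>j\<in>UNIV. a i j t * X (g i j t) $ j)) (at t))"
      using sol by (simp add: is_solution_def AE_restrict_space_iff)
    moreover have "AE t in lebesgue. \<forall>i. t > t0 \<longrightarrow> \<alpha> i \<le> - a i i t \<and> - a i i t \<le> A i"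
      by (intro eventually_all_finite AE_lebesgue_on_imp_AE_future diag that)
    moreover have "AE t in lebesgue. \<forall>i j. t > t0 \<longrightarrow> i \<noteq> j \<longrightarrow> \<bar>a i j t\<bar> \<le> B i j"
    proof (intro eventually_all_finite)
      show "AE t in lebesgue. t > t0 \<longrightarrow> i \<noteq> j \<longrightarrow> \<bar>a i j t\<bar> \<le> B i j" for i j
        using AE_lebesgue_on_imp_AE_future[OF offdiag that(1)] by (cases "i = j") auto
    qed
    moreover have "AE t in lebesgue. \<forall>i j. t > t0 \<longrightarrow> 0 \<le> t - g i j t \<and> t - g i j t \<le> \<sigma> i j"
      by (intro eventually_all_finite AE_lebesgue_on_imp_AE_future delay that)
    ultimately have "AE t in lebesgue. t > t0 \<longrightarrow> good t"
      unfolding good_def by eventually_elim simp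
    then obtain Z where Z: "negligible Z" "{t. \<not> (t > t0 \<longrightarrow> good t)} \<subseteq> Z"
      unfolding eventually_ae_filter_negligible by blast
    then have good: "good t" if "t > t0" "t \<notin> Z" for t using that by blast
    interpret delay_trajectory a g \<alpha> A B \<sigma> r t0 X Z
      using Z(1) \<alpha> A_nonneg B_nonneg \<sigma>_nonneg \<sigma>_le sol good[unfolded good_def]
      by unfold_locales (simp_all add: is_solution_def)
    have X_eq: "X s = \<phi> s" if "s \<in> {t0 - r..t0}" for s using sol that by (simp add: is_solution_def)
    have "compact ((\<lambda>s. N (\<phi> s)) ` {t0 - r..t0})"
      by (intro compact_continuous_image continuous_on_compose2[OF is_norm_continuous_on[OF N, of UNIV] \<phi>]) auto
    then have "bdd_above ((\<lambda>s. N (\<phi> s)) ` {t0 - r..t0})"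
      by (intro bounded_imp_bdd_above compact_imp_bounded)
    then have bdd: "bdd_above ((\<lambda>s. N (\<phi> s)) ` {t0 - r..<t0})"
      by (rule bdd_above_mono) auto
    have sup: "N (\<phi> s) \<le> sup_or_zero ((\<lambda>s. N (\<phi> s)) ` {t0 - r..<t0})" if "t0 - r \<le> s" "s < t0" for s
      using that cSUP_upper[OF _ bdd, of s] by (auto simp: sup_or_zero_def)
    \<comment> \<open>For \<open>r = 0\<close> the initial interval without its right endpoint is empty.\<close>
    have sup_nonneg: "0 \<le> sup_or_zero ((\<lambda>s. N (\<phi> s)) ` {t0 - r..<t0})"
    proof (cases "r = 0")
      case True
      then show ?thesis by (simp add: sup_or_zero_def)
    next
      case False
      then show ?thesis using sup[of "t0 - r"] N_nonneg[of "\<phi> (t0 - r)"] r_nonneg by simp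
    qed
    have J: "0 \<le> C * ?J" using C(1) N_nonneg sup_nonneg by simp
    have NX: "N (X s) \<le> ?J" if "t0 - r \<le> s" "s \<le> t0" for s
      using sup[of s] sup_nonneg N_nonneg[of "X t0"] X_eq[of s] that by (cases "s = t0") auto
    have init: "\<bar>X s $ j\<bar> \<le> C * ?J" if "t0 - r \<le> s" "s \<le> t0" for s j
      using C(2)[of "X s" j] mult_left_mono[OF NX[OF that], of C] C(1) by linarith
    have contX: "continuous_on {t0 - r..t0} X"
      by (rule continuous_on_eq[OF \<phi>]) (simp add: X_eq)
    have comp: "\<bar>X t $ i\<bar> \<le> K * (C * ?J) * v $ i * exp (- l * (t - t0))" for i
      unfolding K_def
      using l v(1) contX J init \<open>t \<ge> t0\<close> by (intro weighted_exponential_bound) (auto simp: less_imp_le)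
    have "N (X t) \<le> (\<Sum>i\<in>UNIV. \<bar>X t $ i\<bar> * N (axis i 1))" by (rule is_norm_le_sum[OF N])
    also have "\<dots> \<le> (\<Sum>i\<in>UNIV. K * (C * ?J) * v $ i * exp (- l * (t - t0)) * N (axis i 1))"
      by (intro sum_mono mult_right_mono comp N_nonneg)
    also have "\<dots> = M * exp (- l * (t - t0)) * ?J"
      by (simp add: M_def sum_distrib_left sum_distrib_right mult_ac)
    finally show ?thesis .
  qed
  have "M > 0"
  proof -
    have K: "K > 0" unfolding K_def
    proof (rule sum_pos)
      show "0 < 1 / v $ k + 2 * A k * exp (l * r) / margin \<alpha> A B \<sigma> r (($) v) l k" for k
        using v(1)[of k] A_nonneg[of k] l(2)[of k] by (intro add_pos_nonneg) auto
    qed auto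
    have "N (axis i 1) > 0" for i :: 'm
      using N N_nonneg[of "axis i 1"] unfolding is_norm_def by (metis axis_eq_0_iff less_eq_real_def zero_neq_one)
    then show ?thesis unfolding M_def using K C(1) v(1) by (intro sum_pos) auto
  qed
  then show ?thesis
    unfolding exponentially_stable_def r_def[symmetric]
    using l(1) estimate by blast
qed

end
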